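(* Denote $\lambda_\pm:=(\lambda,\varepsilon_1\pm\varepsilon_2)$ and define $$H_\pm:=\frac{\theta_1(\lambda_\pm-\hbar)}{\theta_1(\lambda_\pm)}T^\hbar_{\varepsilon_1\pm\varepsilon_2}+\frac{\theta_1(-\lambda_\pm-\hbar)}{\theta_1(-\lambda_\pm)}T^\hbar_{-(\varepsilon_1\pm\varepsilon_2)}.$$ Then $$\widetilde{M_1}=H_+H_-,\qquad\widetilde{M_2}=H_+^2+H_-^2.$$
   Context: For fixed $\tau$ in the upper half plane, $\theta_1(z)=\theta_1(z|\tau)=\sum_{k\in\mathbb{Z}}\exp\left[2\pi i\left((z+\tfrac12)(k+\tfrac12)+\tfrac12(k+\tfrac12)^2\tau\right)\right]$. Let $\mathfrak{h}^*=\mathbb{C}\varepsilon_1\oplus\mathbb{C}\varepsilon_2$ with the symmetric bilinear form $(\varepsilon_j,\varepsilon_k)=\frac12\delta_{jk}$; for $\lambda,p\in\mathfrak{h}^*$ write $\lambda_p:=(\lambda,p)$. Fix $\hbar\in\mathbb{C}$. For $\beta\in\mathfrak{h}^*$, $T^\hbar_\beta f(\lambda):=f(\lambda+\hbar\beta)$. Let $\mathcal{P}_1=\{\pm\varepsilon_1,\pm\varepsilon_2\}$. The difference operators, acting on meromorphic functions on $\mathfrak{h}^*$, are $$\widetilde{M_1}=\sum_{p\in\mathcal{P}_1}\ \prod_{q\in\mathcal{P}_1,\,q\ne\pm p}\frac{\theta_1(\lambda_{p+q}-\hbar)}{\theta_1(\lambda_{p+q})}\,T^\hbar_{2p},$$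 $$\widetilde{M_2}=\sum_{p=\pm\varepsilon_1,\ q=\pm\varepsilon_2}\left(\frac{\theta_1(\lambda_{p+q}-\hbar)}{\theta_1(\lambda_{p+q}+\hbar)}T^\hbar_{2p}T^\hbar_{2q}+\frac{\theta_1(\lambda_{p+q}-\hbar)\,\theta_1(\lambda_{p+q}+2\hbar)}{\theta_1(\lambda_{p+q})\,\theta_1(\lambda_{p+q}+\hbar)}\right).$$ *)

theory Defs
  imports "HOL-Complex_Analysis.Complex_Analysis"
begin

section \<open>Meromorphic functions on \<open>\<complex>\<^sup>2\<close>\<close>

text \<open>The space \<open>\<hh>\<^sup>*\<close> is the type \<^typ>\<open>complex ^ 2\<close>; complex scalars act by \<^const>\<open>vector_scalar_mult\<close>.
  On open sets, holomorphic means Frechet differentiable with complex-linear derivative.\<close>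

definition holo2_on :: "(complex ^ 2 \<Rightarrow> complex) \<Rightarrow> (complex ^ 2) set \<Rightarrow> bool" where
  "holo2_on f U \<longleftrightarrow>
     (\<forall>z\<in>U. \<exists>L. (f has_derivative L) (at z) \<and> (\<forall>c v. L (c *s v) = c * L v))"

definition nowhere_locally_zero :: "(complex ^ 2 \<Rightarrow> complex) \<Rightarrow> (complex ^ 2) set \<Rightarrow> bool" where
  "nowhere_locally_zero h U \<longleftrightarrow> (\<forall>V. open V \<and> V \<subseteq> U \<and> V \<noteq> {} \<longrightarrow> (\<exists>w\<in>V. h w \<noteq> 0))"

text \<open>A meromorphic function is locally a quotient of holomorphic functions whose denominator
  does not vanish identically on any nonempty open set. At the zeros of the chosen denominator
  the value is arbitrary, so functions are identified when they agree on a dense open set.\<close>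

definition meromorphic2 :: "(complex ^ 2 \<Rightarrow> complex) \<Rightarrow> bool" where
  "meromorphic2 f \<longleftrightarrow>
     (\<forall>z. \<exists>U g h. open U \<and> z \<in> U \<and> holo2_on g U \<and> holo2_on h U \<and> nowhere_locally_zero h U \<and>
        (\<forall>w\<in>U. h w \<noteq> 0 \<longrightarrow> f w = g w / h w))"

definition generic_eq :: "(complex ^ 2 \<Rightarrow> complex) \<Rightarrow> (complex ^ 2 \<Rightarrow> complex) \<Rightarrow> bool" where
  "generic_eq f g \<longleftrightarrow> (\<exists>D. open D \<and> closure D = UNIV \<and> (\<forall>w\<in>D. f w = g w))"

definition mero_rel :: "(complex ^ 2 \<Rightarrow> complex) \<Rightarrow> (complex ^ 2 \<Rightarrow> complex) \<Rightarrow> bool" where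
  "mero_rel f g \<longleftrightarrow> meromorphic2 f \<and> meromorphic2 g \<and> generic_eq f g"


subsection \<open>Closure properties\<close>

lemma holo2_on_subset: "holo2_on f U \<Longrightarrow> V \<subseteq> U \<Longrightarrow> holo2_on f V"
  unfolding holo2_on_def by blast

lemma holo2_on_const: "holo2_on (\<lambda>_. c) U"
  unfolding holo2_on_def by (intro ballI exI[of _ "\<lambda>_. 0"]) auto

lemma holo2_on_add:
  assumes "holo2_on f U" "holo2_on g U"
  shows "holo2_on (\<lambda>z. f z + g z) U"
  unfolding holo2_on_def
proof
  fix z assume "z \<in> U"
  then obtain L M where "(f has_derivative L) (at z)" "\<forall>c v. L (c *s v) = c * L v"
    "(g has_derivative M) (at z)" "\<forall>c v. M (c *s v) = c * M v"
    using assms unfolding holo2_on_def by blast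
  then show "\<exists>L. ((\<lambda>z. f z + g z) has_derivative L) (at z) \<and> (\<forall>c v. L (c *s v) = c * L v)"
    by (intro exI[of _ "\<lambda>v. L v + M v"]) (auto intro!: derivative_intros simp: algebra_simps)
qed

lemma holo2_on_mult:
  assumes "holo2_on f U" "holo2_on g U"
  shows "holo2_on (\<lambda>z. f z * g z) U"
  unfolding holo2_on_def
proof
  fix z assume "z \<in> U"
  then obtain L M where "(f has_derivative L) (at z)" "\<forall>c v. L (c *s v) = c * L v"
    "(g has_derivative M) (at z)" "\<forall>c v. M (c *s v) = c * M v"
    using assms unfolding holo2_on_def by blast
  then show "\<exists>L. ((\<lambda>z. f z * g z) has_derivative L) (at z) \<and> (\<forall>c v. L (c *s v) = c * L v)"
    by (intro exI[of _ "\<lambda>v. f z * M v + L v * g z"] conjI has_derivative_mult)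
       (auto simp: algebra_simps)
qed

lemma holo2_on_translate:
  assumes "holo2_on f U"
  shows "holo2_on (\<lambda>z. f (z + b)) {z. z + b \<in> U}"
  unfolding holo2_on_def
proof
  fix z assume "z \<in> {z. z + b \<in> U}"
  then obtain L where L: "(f has_derivative L) (at (z + b))" "\<forall>c v. L (c *s v) = c * L v"
    using assms unfolding holo2_on_def by blast
  have "((\<lambda>z. z + b) has_derivative (\<lambda>v. v)) (at z)"
    by (auto intro!: derivative_eq_intros)
  from has_derivative_compose[OF this, of f L] L
  show "\<exists>L. ((\<lambda>z. f (z + b)) has_derivative L) (at z) \<and> (\<forall>c v. L (c *s v) = c * L v)"
    by auto
qed

lemma holo2_on_imp_continuous_on: "holo2_on f U \<Longrightarrow> continuous_on U f"
  unfolding holo2_on_def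
  by (meson continuous_at_imp_continuous_on has_derivative_continuous)

lemma open_nonzero_holo2:
  assumes "open U" "holo2_on f U"
  shows "open {z\<in>U. f z \<noteq> 0}"
proof -
  have "{z\<in>U. f z \<noteq> 0} = U \<inter> f -` (- {0})" by auto
  then show ?thesis
    using continuous_open_preimage[OF holo2_on_imp_continuous_on[OF assms(2)] assms(1), of "- {0}"]
    by (simp add: open_Compl)
qed

lemma nowhere_locally_zero_subset:
  "nowhere_locally_zero h U \<Longrightarrow> V \<subseteq> U \<Longrightarrow> nowhere_locally_zero h V"
  unfolding nowhere_locally_zero_def by (meson subset_trans)

lemma nowhere_locally_zero_mult:
  assumes "holo2_on g U" "nowhere_locally_zero g U" "nowhere_locally_zero h U"
  shows "nowhere_locally_zero (\<lambda>z. g z * h z) U"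
  unfolding nowhere_locally_zero_def
proof (intro allI impI)
  fix V assume V: "open V \<and> V \<subseteq> U \<and> V \<noteq> {}"
  define W where "W = {z\<in>V. g z \<noteq> 0}"
  have "open W" unfolding W_def
    using V assms(1) by (intro open_nonzero_holo2) (auto intro: holo2_on_subset)
  moreover have "W \<noteq> {}" using assms(2) V unfolding nowhere_locally_zero_def W_def by blast
  moreover have "W \<subseteq> U" using V W_def by auto
  ultimately obtain w where "w \<in> W" "h w \<noteq> 0"
    using assms(3) unfolding nowhere_locally_zero_def by blast
  then show "\<exists>w\<in>V. g w * h w \<noteq> 0" unfolding W_def by auto
qed

lemma continuous_vec_line: "continuous_on S (\<lambda>t::complex. a + t *s (b :: complex ^ 2))"
  by (auto intro!: continuous_intros simp: continuous_on_vec_lambda vector_scalar_mult_def)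

lemma vec_line_has_derivative:
  "((\<lambda>t::complex. a + t *s (b :: complex ^ 2)) has_derivative (\<lambda>s. s *s b)) (at t)"
proof -
  have "bounded_linear (\<lambda>t::complex. t *s b)"
  proof -
    have "linear (\<lambda>t::complex. t *s b)"
      by (rule linearI) (auto simp: vec_eq_iff algebra_simps)
    then show ?thesis by (simp add: linear_conv_bounded_linear)
  qed
  then have "((\<lambda>t::complex. t *s b) has_derivative (\<lambda>s. s *s b)) (at t)"
    by (rule bounded_linear_imp_has_derivative)
  from has_derivative_add[OF has_derivative_const this, of a] show ?thesis
    by simp
qed

text \<open>Identity theorem on a ball, by restriction to complex lines.\<close>

lemma holo2_identity:
  assumes "holo2_on f (ball z r)" "open V" "V \<subseteq> ball z r" "a \<in> V" "\<And>w. w \<in> V \<Longrightarrow> f w = 0"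
    and w: "w \<in> ball z r"
  shows "f w = 0"
proof -
  define l where "l = (\<lambda>t::complex. a + t *s (w - a))"
  define S where "S = l -` ball z r"
  define T where "T = l -` V"
  have cl: "continuous_on UNIV l" unfolding l_def by (rule continuous_vec_line)
  have oS: "open S" "open T" unfolding S_def T_def
    using cl assms(2) by (auto intro: open_vimage)
  have "convex S"
    unfolding convex_alt
  proof (intro ballI allI impI)
    fix x y u assume xy: "x \<in> S" "y \<in> S" and u: "0 \<le> (u::real) \<and> u \<le> 1"
    have "l ((1 - u) *\<^sub>R x + u *\<^sub>R y) = (1 - u) *\<^sub>R l x + u *\<^sub>R l y"
    proof (rule vec_eq_iff[THEN iffD2], rule allI)
      fix i
      show "l ((1 - u) *\<^sub>R x + u *\<^sub>R y) $ i = ((1 - u) *\<^sub>R l x + u *\<^sub>R l y) $ i"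
        unfolding l_def vector_add_component vector_smult_component vector_scaleR_component
          scaleR_conv_of_real[where 'a = complex] of_real_diff of_real_1
        by algebra
    qed
    then show "(1 - u) *\<^sub>R x + u *\<^sub>R y \<in> S"
      using convexD_alt[OF convex_ball, of "l x" z r "l y" u] xy u unfolding S_def by auto
  qed
  then have "connected S" by (rule convex_connected)
  have hol: "(\<lambda>t. f (l t)) holomorphic_on S"
    unfolding holomorphic_on_open[OF oS(1)]
  proof
    fix t assume "t \<in> S"
    then obtain L where L: "(f has_derivative L) (at (l t))" "\<forall>c v. L (c *s v) = c * L v"
      using assms(1) unfolding holo2_on_def S_def by blast
    have "((\<lambda>t. f (l t)) has_derivative (\<lambda>s. L (s *s (w - a)))) (at t)"
      using has_derivative_compose[OF vec_line_has_derivative, of f L a t "w - a"] L(1)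
      unfolding l_def by simp
    moreover have "(\<lambda>s. L (s *s (w - a))) = (*) (L (w - a))"
      by (rule ext) (metis L(2) mult.commute)
    ultimately have "((\<lambda>t. f (l t)) has_field_derivative L (w - a)) (at t)"
      unfolding has_field_derivative_def by metis
    then show "\<exists>f'. ((\<lambda>t. f (l t)) has_field_derivative f') (at t)" by blast
  qed
  have TS: "T \<subseteq> S" using assms(3) unfolding S_def T_def by auto
  have "0 \<in> T" unfolding T_def l_def using assms(4) by simp
  then have Tne: "T \<noteq> {}" by blast
  have S1: "1 \<in> S" unfolding S_def l_def using w by simp
  have T0: "f (l t) = 0" if "t \<in> T" for t
    using that assms(5) unfolding T_def by simp
  have "f (l 1) = 0"
    using analytic_continuation_open[OF oS(2,1) Tne \<open>connected S\<close> TS hol holomorphic_on_const T0 S1] .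
  moreover have "l 1 = w" unfolding l_def by simp
  ultimately show ?thesis by simp
qed

lemma holo2_zero_or_nowhere:
  assumes "holo2_on f (ball z r)"
  shows "(\<forall>w\<in>ball z r. f w = 0) \<or> nowhere_locally_zero f (ball z r)"
proof (cases "nowhere_locally_zero f (ball z r)")
  case False
  then obtain V where V: "open V" "V \<subseteq> ball z r" "V \<noteq> {}" "\<forall>w\<in>V. f w = 0"
    unfolding nowhere_locally_zero_def by blast
  then obtain a where "a \<in> V" by blast
  then show ?thesis using holo2_identity[OF assms V(1,2)] V(4) by blast
qed auto

lemma meromorphic2E:
  assumes "meromorphic2 f"
  obtains r g h where "r > 0" "holo2_on g (ball z r)" "holo2_on h (ball z r)"
    "nowhere_locally_zero h (ball z r)" "\<And>w. w \<in> ball z r \<Longrightarrow> h w \<noteq> 0 \<Longrightarrow> f w = g w / h w"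
proof -
  obtain U g h where U: "open U" "z \<in> U" "holo2_on g U" "holo2_on h U" "nowhere_locally_zero h U"
    "\<forall>w\<in>U. h w \<noteq> 0 \<longrightarrow> f w = g w / h w"
    using assms unfolding meromorphic2_def by meson
  obtain r where r: "r > 0" "ball z r \<subseteq> U" using U open_contains_ball by metis
  show ?thesis
    by (rule that[of r g h])
       (use U r holo2_on_subset nowhere_locally_zero_subset in \<open>blast+\<close>)
qed

lemma meromorphic2I:
  assumes "\<And>z. \<exists>r>0. \<exists>g h. holo2_on g (ball z r) \<and> holo2_on h (ball z r) \<and>
    nowhere_locally_zero h (ball z r) \<and> (\<forall>w\<in>ball z r. h w \<noteq> 0 \<longrightarrow> f w = g w / h w)"
  shows "meromorphic2 f"
  unfolding meromorphic2_def
proof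
  fix z
  from assms[of z] obtain r g h where r: "r > 0" "holo2_on g (ball z r)" "holo2_on h (ball z r)"
    "nowhere_locally_zero h (ball z r)" "\<forall>w\<in>ball z r. h w \<noteq> 0 \<longrightarrow> f w = g w / h w" by blast
  show "\<exists>U g h. open U \<and> z \<in> U \<and> holo2_on g U \<and> holo2_on h U \<and> nowhere_locally_zero h U \<and>
        (\<forall>w\<in>U. h w \<noteq> 0 \<longrightarrow> f w = g w / h w)"
    by (rule exI[of _ "ball z r"], rule exI[of _ g], rule exI[of _ h]) (use r in auto)
qed

lemma nowhere_locally_zero_one: "nowhere_locally_zero (\<lambda>_. 1) U"
  unfolding nowhere_locally_zero_def by auto

lemma holo2_imp_meromorphic2: "holo2_on f UNIV \<Longrightarrow> meromorphic2 f"
  unfolding meromorphic2_def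
  by (intro allI exI[of _ UNIV] exI[of _ f] exI[of _ "\<lambda>_. 1"])
     (auto simp: holo2_on_const nowhere_locally_zero_one)

lemma meromorphic2_const: "meromorphic2 (\<lambda>_. c)"
  by (rule holo2_imp_meromorphic2[OF holo2_on_const])

lemma meromorphic2_common_ball:
  assumes "meromorphic2 f" "meromorphic2 g"
  obtains r f1 f2 g1 g2 where "r > 0"
    "holo2_on f1 (ball z r)" "holo2_on f2 (ball z r)" "nowhere_locally_zero f2 (ball z r)"
    "holo2_on g1 (ball z r)" "holo2_on g2 (ball z r)" "nowhere_locally_zero g2 (ball z r)"
    "\<And>w. w \<in> ball z r \<Longrightarrow> f2 w \<noteq> 0 \<Longrightarrow> f w = f1 w / f2 w"
    "\<And>w. w \<in> ball z r \<Longrightarrow> g2 w \<noteq> 0 \<Longrightarrow> g w = g1 w / g2 w"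
proof -
  obtain r f1 f2 where F: "r > 0" "holo2_on f1 (ball z r)" "holo2_on f2 (ball z r)"
    "nowhere_locally_zero f2 (ball z r)" "\<And>w. w \<in> ball z r \<Longrightarrow> f2 w \<noteq> 0 \<Longrightarrow> f w = f1 w / f2 w"
    using meromorphic2E[OF assms(1)] by metis
  obtain s g1 g2 where G: "s > 0" "holo2_on g1 (ball z s)" "holo2_on g2 (ball z s)"
    "nowhere_locally_zero g2 (ball z s)" "\<And>w. w \<in> ball z s \<Longrightarrow> g2 w \<noteq> 0 \<Longrightarrow> g w = g1 w / g2 w"
    using meromorphic2E[OF assms(2)] by metis
  have sub: "ball z (min r s) \<subseteq> ball z r" "ball z (min r s) \<subseteq> ball z s" by auto
  show ?thesis
    by (rule that[of "min r s" f1 f2 g1 g2])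
       (use F(1) G(1) holo2_on_subset[OF F(2) sub(1)] holo2_on_subset[OF F(3) sub(1)]
          holo2_on_subset[OF G(2) sub(2)] holo2_on_subset[OF G(3) sub(2)]
          nowhere_locally_zero_subset[OF F(4) sub(1)] nowhere_locally_zero_subset[OF G(4) sub(2)]
        in \<open>simp_all add: F(5) G(5)\<close>)
qed

lemma meromorphic2_add:
  assumes "meromorphic2 f" "meromorphic2 g"
  shows "meromorphic2 (\<lambda>z. f z + g z)"
proof (rule meromorphic2I)
  fix z
  obtain r f1 f2 g1 g2 where *: "r > 0"
    "holo2_on f1 (ball z r)" "holo2_on f2 (ball z r)" "nowhere_locally_zero f2 (ball z r)"
    "holo2_on g1 (ball z r)" "holo2_on g2 (ball z r)" "nowhere_locally_zero g2 (ball z r)"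
    "\<And>w. w \<in> ball z r \<Longrightarrow> f2 w \<noteq> 0 \<Longrightarrow> f w = f1 w / f2 w"
    "\<And>w. w \<in> ball z r \<Longrightarrow> g2 w \<noteq> 0 \<Longrightarrow> g w = g1 w / g2 w"
    using meromorphic2_common_ball[OF assms, of z] by metis
  show "\<exists>r>0. \<exists>g' h. holo2_on g' (ball z r) \<and> holo2_on h (ball z r) \<and>
    nowhere_locally_zero h (ball z r) \<and> (\<forall>w\<in>ball z r. h w \<noteq> 0 \<longrightarrow> f w + g w = g' w / h w)"
    by (rule exI[of _ r], intro conjI *(1) exI[of _ "\<lambda>w. f1 w * g2 w + g1 w * f2 w"]
          exI[of _ "\<lambda>w. f2 w * g2 w"] holo2_on_add holo2_on_mult nowhere_locally_zero_mult
          *(2-7) ballI impI)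
       (use *(8,9) in \<open>auto simp: field_simps\<close>)
qed

lemma meromorphic2_mult:
  assumes "meromorphic2 f" "meromorphic2 g"
  shows "meromorphic2 (\<lambda>z. f z * g z)"
proof (rule meromorphic2I)
  fix z
  obtain r f1 f2 g1 g2 where *: "r > 0"
    "holo2_on f1 (ball z r)" "holo2_on f2 (ball z r)" "nowhere_locally_zero f2 (ball z r)"
    "holo2_on g1 (ball z r)" "holo2_on g2 (ball z r)" "nowhere_locally_zero g2 (ball z r)"
    "\<And>w. w \<in> ball z r \<Longrightarrow> f2 w \<noteq> 0 \<Longrightarrow> f w = f1 w / f2 w"
    "\<And>w. w \<in> ball z r \<Longrightarrow> g2 w \<noteq> 0 \<Longrightarrow> g w = g1 w / g2 w"
    using meromorphic2_common_ball[OF assms, of z] by metis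
  show "\<exists>r>0. \<exists>g' h. holo2_on g' (ball z r) \<and> holo2_on h (ball z r) \<and>
    nowhere_locally_zero h (ball z r) \<and> (\<forall>w\<in>ball z r. h w \<noteq> 0 \<longrightarrow> f w * g w = g' w / h w)"
    by (rule exI[of _ r], intro conjI *(1) exI[of _ "\<lambda>w. f1 w * g1 w"]
          exI[of _ "\<lambda>w. f2 w * g2 w"] holo2_on_add holo2_on_mult nowhere_locally_zero_mult
          *(2-7) ballI impI)
       (use *(8,9) in \<open>auto simp: field_simps\<close>)
qed

lemma meromorphic2_inverse:
  assumes "meromorphic2 f"
  shows "meromorphic2 (\<lambda>z. inverse (f z))"
proof (rule meromorphic2I)
  fix z
  obtain r g h where *: "r > 0" "holo2_on g (ball z r)" "holo2_on h (ball z r)"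
    "nowhere_locally_zero h (ball z r)" "\<And>w. w \<in> ball z r \<Longrightarrow> h w \<noteq> 0 \<Longrightarrow> f w = g w / h w"
    using meromorphic2E[OF assms] by metis
  show "\<exists>r>0. \<exists>g h. holo2_on g (ball z r) \<and> holo2_on h (ball z r) \<and>
    nowhere_locally_zero h (ball z r) \<and> (\<forall>w\<in>ball z r. h w \<noteq> 0 \<longrightarrow> inverse (f w) = g w / h w)"
  proof (cases "\<forall>w\<in>ball z r. g w = 0")
    case True
    then show ?thesis
      by (intro exI[of _ r] conjI *(1) exI[of _ "\<lambda>_. 0"] exI[of _ h] *(3,4) holo2_on_const)
         (use *(5) in auto)
  next
    case False
    then have "nowhere_locally_zero g (ball z r)" using holo2_zero_or_nowhere[OF *(2)] by blast
    then have "nowhere_locally_zero (\<lambda>w. g w * h w) (ball z r)"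
      using nowhere_locally_zero_mult *(2,4) by blast
    moreover have "inverse (f w) = h w * h w / (g w * h w)"
      if "w \<in> ball z r" "g w * h w \<noteq> 0" for w
      using *(5)[OF that(1)] that(2) by simp
    moreover have "holo2_on (\<lambda>w. h w * h w) (ball z r)" "holo2_on (\<lambda>w. g w * h w) (ball z r)"
      using *(2,3) holo2_on_mult by blast+
    ultimately show ?thesis using *(1)
      by (intro exI[of _ r] conjI exI[of _ "\<lambda>w. h w * h w"] exI[of _ "\<lambda>w. g w * h w"]) simp_all
  qed
qed

lemma open_translate: "open U \<Longrightarrow> open {z. z + b \<in> (U :: (complex ^ 2) set)}"
  using open_vimage[of U "\<lambda>z. z + b", OF _ continuous_on_add[OF continuous_on_id continuous_on_const]]
  by (simp add: vimage_def)

lemma meromorphic2_translate: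
  assumes "meromorphic2 f"
  shows "meromorphic2 (\<lambda>z. f (z + b))"
  unfolding meromorphic2_def
proof
  fix z
  obtain U g h where U: "open U" "z + b \<in> U" "holo2_on g U" "holo2_on h U"
    "nowhere_locally_zero h U" "\<forall>w\<in>U. h w \<noteq> 0 \<longrightarrow> f w = g w / h w"
    using assms unfolding meromorphic2_def by meson
  have "nowhere_locally_zero (\<lambda>w. h (w + b)) {z. z + b \<in> U}"
    unfolding nowhere_locally_zero_def
  proof (intro allI impI)
    fix V assume V: "open V \<and> V \<subseteq> {z. z + b \<in> U} \<and> V \<noteq> {}"
    define W where "W = {z. z + (- b) \<in> V}"
    obtain v where "v \<in> V" using V by blast
    then have "v + b \<in> W" unfolding W_def by simp
    moreover have "open W" unfolding W_def using V open_translate by blast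
    moreover have "W \<subseteq> U" using V unfolding W_def by force
    ultimately obtain w where "w \<in> W" "h w \<noteq> 0"
      using U(5) unfolding nowhere_locally_zero_def by blast
    then show "\<exists>w\<in>V. h (w + b) \<noteq> 0"
      by (intro bexI[of _ "w + (- b)"]) (auto simp: W_def)
  qed
  then show "\<exists>U g h. open U \<and> z \<in> U \<and> holo2_on g U \<and> holo2_on h U \<and> nowhere_locally_zero h U \<and>
        (\<forall>w\<in>U. h w \<noteq> 0 \<longrightarrow> f (w + b) = g w / h w)"
    by (intro exI[of _ "{z. z + b \<in> U}"] exI[of _ "\<lambda>w. g (w + b)"] exI[of _ "\<lambda>w. h (w + b)"])
       (use U open_translate holo2_on_translate in auto)
qed


subsection \<open>Generic equality\<close>

lemma dense_iff: "closure D = (UNIV :: (complex ^ 2) set) \<longleftrightarrow> (\<forall>V. open V \<and> V \<noteq> {} \<longrightarrow> D \<inter> V \<noteq> {})"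
proof
  assume "closure D = UNIV"
  then show "\<forall>V. open V \<and> V \<noteq> {} \<longrightarrow> D \<inter> V \<noteq> {}"
    using open_Int_closure_eq_empty[of _ D] by (metis Int_UNIV_right Int_commute)
next
  assume *: "\<forall>V. open V \<and> V \<noteq> {} \<longrightarrow> D \<inter> V \<noteq> {}"
  have "D \<inter> - closure D = {}" using closure_subset by blast
  then show "closure D = UNIV" using * open_Compl[OF closed_closure[of D]] by blast
qed

lemma dense_open_Int:
  fixes D E :: "(complex ^ 2) set"
  assumes "open D" "closure D = UNIV" "closure E = UNIV"
  shows "closure (D \<inter> E) = UNIV"
  unfolding dense_iff
proof (intro allI impI)
  fix V assume V: "open V \<and> V \<noteq> ({} :: (complex ^ 2) set)"
  then have "open (D \<inter> V) \<and> D \<inter> V \<noteq> {}"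
    using assms(1,2) unfolding dense_iff by blast
  then have "E \<inter> (D \<inter> V) \<noteq> {}" using assms(3) unfolding dense_iff by blast
  then show "D \<inter> E \<inter> V \<noteq> {}" by blast
qed

lemma generic_eq_refl: "generic_eq f f"
  unfolding generic_eq_def by (intro exI[of _ UNIV]) auto

lemma generic_eq_sym: "generic_eq f g \<Longrightarrow> generic_eq g f"
  unfolding generic_eq_def by metis

lemma generic_eq_map2:
  assumes "generic_eq f f'" "generic_eq g g'"
  shows "generic_eq (\<lambda>w. F (f w) (g w)) (\<lambda>w. F (f' w) (g' w))"
proof -
  obtain D E where "open D" "closure D = UNIV" "\<forall>w\<in>D. f w = f' w"
    "open E" "closure E = UNIV" "\<forall>w\<in>E. g w = g' w"
    using assms unfolding generic_eq_def by blast
  then show ?thesis unfolding generic_eq_def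
    by (intro exI[of _ "D \<inter> E"]) (auto simp: dense_open_Int)
qed

lemma generic_eq_trans:
  assumes "generic_eq f g" "generic_eq g h"
  shows "generic_eq f h"
proof -
  obtain D E where "open D" "closure D = UNIV" "\<forall>w\<in>D. f w = g w"
    "open E" "closure E = UNIV" "\<forall>w\<in>E. g w = h w"
    using assms unfolding generic_eq_def by blast
  then show ?thesis unfolding generic_eq_def
    by (intro exI[of _ "D \<inter> E"]) (auto simp: dense_open_Int)
qed

lemma generic_eq_translate:
  assumes "generic_eq f g"
  shows "generic_eq (\<lambda>z. f (z + b)) (\<lambda>z. g (z + b))"
proof -
  obtain D where D: "open D" "closure D = UNIV" "\<forall>w\<in>D. f w = g w"
    using assms unfolding generic_eq_def by blast
  have "closure {z. z + b \<in> D} = UNIV"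
    unfolding dense_iff
  proof (intro allI impI)
    fix V assume V: "open V \<and> V \<noteq> ({} :: (complex ^ 2) set)"
    then obtain v where "v \<in> V" by blast
    then have "v + b \<in> {z. z + (- b) \<in> V}" by simp
    then obtain w where "w \<in> D" "w + (- b) \<in> V"
      using D(2) V open_translate[of V "- b"] unfolding dense_iff by blast
    then have "w + (- b) \<in> {z. z + b \<in> D} \<inter> V" by simp
    then show "{z. z + b \<in> D} \<inter> V \<noteq> {}" by blast
  qed
  then show ?thesis unfolding generic_eq_def
    using D open_translate by (intro exI[of _ "{z. z + b \<in> D}"]) auto
qed

text \<open>A meromorphic function that is not generically zero is generically nonzero,
  because \<open>\<complex>\<^sup>2\<close> is connected.\<close>

lemma meromorphic2_nonzero_dense:
  assumes "meromorphic2 f" "\<not> generic_eq f (\<lambda>_. 0)"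
  shows "\<exists>D. open D \<and> closure D = UNIV \<and> (\<forall>w\<in>D. f w \<noteq> 0)"
proof -
  have "\<forall>z. \<exists>r g h. r > 0 \<and> holo2_on g (ball z r) \<and> holo2_on h (ball z r) \<and>
    nowhere_locally_zero h (ball z r) \<and> (\<forall>w\<in>ball z r. h w \<noteq> 0 \<longrightarrow> f w = g w / h w)"
  proof
    fix z
    show "\<exists>r g h. r > 0 \<and> holo2_on g (ball z r) \<and> holo2_on h (ball z r) \<and>
      nowhere_locally_zero h (ball z r) \<and> (\<forall>w\<in>ball z r. h w \<noteq> 0 \<longrightarrow> f w = g w / h w)"
      by (rule meromorphic2E[OF assms(1), of z]) blast
  qed
  from choice[OF this] obtain r where "\<forall>z. \<exists>g h. r z > 0 \<and> holo2_on g (ball z (r z)) \<and>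
    holo2_on h (ball z (r z)) \<and> nowhere_locally_zero h (ball z (r z)) \<and>
    (\<forall>w\<in>ball z (r z). h w \<noteq> 0 \<longrightarrow> f w = g w / h w)" ..
  from choice[OF this] obtain g where "\<forall>z. \<exists>h. r z > 0 \<and> holo2_on (g z) (ball z (r z)) \<and>
    holo2_on h (ball z (r z)) \<and> nowhere_locally_zero h (ball z (r z)) \<and>
    (\<forall>w\<in>ball z (r z). h w \<noteq> 0 \<longrightarrow> f w = g z w / h w)" ..
  from choice[OF this] obtain h where "\<forall>z. r z > 0 \<and> holo2_on (g z) (ball z (r z)) \<and>
    holo2_on (h z) (ball z (r z)) \<and> nowhere_locally_zero (h z) (ball z (r z)) \<and>
    (\<forall>w\<in>ball z (r z). h z w \<noteq> 0 \<longrightarrow> f w = g z w / h z w)" ..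
  then have *: "\<And>z. r z > 0" "\<And>z. holo2_on (g z) (ball z (r z))"
    "\<And>z. holo2_on (h z) (ball z (r z))" "\<And>z. nowhere_locally_zero (h z) (ball z (r z))"
    "\<And>z w. w \<in> ball z (r z) \<Longrightarrow> h z w \<noteq> 0 \<Longrightarrow> f w = g z w / h z w"
    by simp_all
  define A where "A = {z. \<forall>w\<in>ball z (r z). g z w = 0}"
  have opW: "open {w\<in>V. h z w \<noteq> 0}" if "open V" "V \<subseteq> ball z (r z)" for V z
    using that *(3) by (intro open_nonzero_holo2) (auto intro: holo2_on_subset)
  have opG: "open {w\<in>V. g z w \<noteq> 0}" if "open V" "V \<subseteq> ball z (r z)" for V z
    using that *(2) by (intro open_nonzero_holo2) (auto intro: holo2_on_subset)
  have ne: "{w\<in>V. h z w \<noteq> 0} \<noteq> {}" if "open V" "V \<subseteq> ball z (r z)" "V \<noteq> {}" for V z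
    using that *(4)[of z] unfolding nowhere_locally_zero_def by blast
  have same: "x \<in> A \<longleftrightarrow> y \<in> A" if xy: "ball x (r x) \<inter> ball y (r y) \<noteq> {}" for x y
  proof -
    define V where "V = ball x (r x) \<inter> ball y (r y)"
    have V: "open V" "V \<noteq> {}" "V \<subseteq> ball x (r x)" "V \<subseteq> ball y (r y)"
      unfolding V_def using xy by auto
    define W where "W = {w \<in> {w\<in>V. h x w \<noteq> 0}. h y w \<noteq> 0}"
    have W: "open W" "W \<noteq> {}" "W \<subseteq> V"
      unfolding W_def using V opW[of V x] ne[of V x] opW[of "{w\<in>V. h x w \<noteq> 0}" y]
        ne[of "{w\<in>V. h x w \<noteq> 0}" y] by auto
    have eq: "g x w = 0 \<longleftrightarrow> g y w = 0" if "w \<in> W" for w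
    proof -
      have w: "w \<in> V" "h x w \<noteq> 0" "h y w \<noteq> 0" using that unfolding W_def by simp_all
      have "g x w / h x w = g y w / h y w"
        using *(5)[of w x] *(5)[of w y] w V(3,4) by (metis subsetD)
      then show ?thesis using w(2,3) by (metis divide_eq_0_iff)
    qed
    have dir: "b \<in> A" if "a \<in> A" "W \<subseteq> ball a (r a)" "W \<subseteq> ball b (r b)"
      "\<And>w. w \<in> W \<Longrightarrow> g a w = 0 \<longleftrightarrow> g b w = 0" for a b
    proof -
      have "\<forall>w\<in>W. g b w = 0" using that unfolding A_def by blast
      then have "\<not> nowhere_locally_zero (g b) (ball b (r b))"
        using W that(3) unfolding nowhere_locally_zero_def by blast
      then show ?thesis using holo2_zero_or_nowhere[OF *(2)] unfolding A_def by blast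
    qed
    have "W \<subseteq> ball x (r x)" "W \<subseteq> ball y (r y)" using W(3) V(3,4) by blast+
    then show ?thesis using dir[of x y] dir[of y x] eq by blast
  qed
  have "open A" unfolding open_contains_ball
  proof
    fix x assume "x \<in> A"
    have "y \<in> A" if "y \<in> ball x (r x)" for y
    proof -
      have "y \<in> ball x (r x) \<inter> ball y (r y)" using that *(1) by simp
      then show ?thesis using same \<open>x \<in> A\<close> by blast
    qed
    then show "\<exists>e>0. ball x e \<subseteq> A" using *(1)[of x] by blast
  qed
  moreover have "open (- A)" unfolding open_contains_ball
  proof
    fix x assume "x \<in> - A"
    have "y \<in> - A" if "y \<in> ball x (r x)" for y
    proof -
      have "y \<in> ball x (r x) \<inter> ball y (r y)" using that *(1) by simp
      then show ?thesis using same[of x y] \<open>x \<in> - A\<close> by blast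
    qed
    then show "\<exists>e>0. ball x e \<subseteq> - A" using *(1)[of x] by blast
  qed
  ultimately have A: "A = {} \<or> A = UNIV"
    using connected_clopen[of "UNIV :: (complex ^ 2) set"]
    by (auto simp: closed_def)
  have "A \<noteq> UNIV"
  proof
    assume "A = UNIV"
    define D where "D = (\<Union>z. {w\<in>ball z (r z). h z w \<noteq> 0})"
    have "open D" unfolding D_def using opW by blast
    moreover have "closure D = UNIV" unfolding dense_iff
    proof (intro allI impI)
      fix V assume V: "open V \<and> V \<noteq> ({} :: (complex ^ 2) set)"
      then obtain v where v: "v \<in> V" by blast
      have "{w \<in> V \<inter> ball v (r v). h v w \<noteq> 0} \<noteq> {}"
      proof (rule ne)
        show "V \<inter> ball v (r v) \<noteq> {}" using v *(1)[of v] centre_in_ball by blast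
      qed (use V in auto)
      then show "D \<inter> V \<noteq> {}" unfolding D_def by blast
    qed
    moreover have "f w = 0" if wD: "w \<in> D" for w
    proof -
      obtain z where z: "w \<in> ball z (r z)" "h z w \<noteq> 0" using wD unfolding D_def by blast
      then have "g z w = 0" using \<open>A = UNIV\<close> unfolding A_def by blast
      then show ?thesis using *(5)[OF z] by simp
    qed
    ultimately show False using assms(2) unfolding generic_eq_def by blast
  qed
  then have "A = {}" using A by blast
  then have nz: "nowhere_locally_zero (g z) (ball z (r z))" for z
    using holo2_zero_or_nowhere[OF *(2), of z] unfolding A_def by blast
  define D where "D = (\<Union>z. {w\<in>{w\<in>ball z (r z). h z w \<noteq> 0}. g z w \<noteq> 0})"
  have "open D" unfolding D_def using opW opG by blast
  moreover have "closure D = UNIV" unfolding dense_iff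
  proof (intro allI impI)
    fix V assume V: "open V \<and> V \<noteq> ({} :: (complex ^ 2) set)"
    then obtain v where v: "v \<in> V" by blast
    have "nowhere_locally_zero (\<lambda>w. g v w * h v w) (ball v (r v))"
      by (rule nowhere_locally_zero_mult[OF *(2) nz *(4)])
    moreover have "open (V \<inter> ball v (r v)) \<and> V \<inter> ball v (r v) \<subseteq> ball v (r v) \<and> V \<inter> ball v (r v) \<noteq> {}"
      using V v *(1)[of v] centre_in_ball[of v "r v"] by blast
    ultimately have "\<exists>w\<in>V \<inter> ball v (r v). g v w * h v w \<noteq> 0"
      unfolding nowhere_locally_zero_def by blast
    then obtain w where w: "w \<in> V" "w \<in> ball v (r v)" "h v w \<noteq> 0" "g v w \<noteq> 0" by auto
    then have "w \<in> D" unfolding D_def by blast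
    then show "D \<inter> V \<noteq> {}" using w(1) by blast
  qed
  moreover have "f w \<noteq> 0" if wD: "w \<in> D" for w
  proof -
    obtain z where z: "w \<in> ball z (r z)" "h z w \<noteq> 0" "g z w \<noteq> 0"
      using wD unfolding D_def by blast
    then show ?thesis using *(5)[OF z(1,2)] by simp
  qed
  ultimately show ?thesis by blast
qed


subsection \<open>The field of meromorphic functions\<close>

lemma part_equivp_mero_rel: "part_equivp mero_rel"
proof (rule part_equivpI)
  show "\<exists>x. mero_rel x x"
    using meromorphic2_const generic_eq_refl unfolding mero_rel_def by blast
  show "symp mero_rel"
    by (rule sympI) (auto simp: mero_rel_def generic_eq_sym)
  show "transp mero_rel"
    by (rule transpI) (auto simp: mero_rel_def intro: generic_eq_trans)
qed

quotient_type mero = "complex ^ 2 \<Rightarrow> complex" / partial: mero_rel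
  by (rule part_equivp_mero_rel)

instantiation mero :: field
begin

lift_definition zero_mero :: mero is "\<lambda>_. 0"
  by (simp add: mero_rel_def meromorphic2_const generic_eq_refl)

lift_definition one_mero :: mero is "\<lambda>_. 1"
  by (simp add: mero_rel_def meromorphic2_const generic_eq_refl)

lift_definition plus_mero :: "mero \<Rightarrow> mero \<Rightarrow> mero" is "\<lambda>f g z. f z + g z"
  using generic_eq_map2[where F = "(+)"] by (auto simp: mero_rel_def meromorphic2_add)

lift_definition times_mero :: "mero \<Rightarrow> mero \<Rightarrow> mero" is "\<lambda>f g z. f z * g z"
  using generic_eq_map2[where F = "(*)"] by (auto simp: mero_rel_def meromorphic2_mult)

lift_definition uminus_mero :: "mero \<Rightarrow> mero" is "\<lambda>f z. - f z"
  using generic_eq_map2[where F = "\<lambda>x y. - x"] meromorphic2_mult[OF meromorphic2_const[of "- 1"]]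
  by (auto simp: mero_rel_def)

lift_definition inverse_mero :: "mero \<Rightarrow> mero" is "\<lambda>f z. inverse (f z)"
  using generic_eq_map2[where F = "\<lambda>x y. inverse x"] by (auto simp: mero_rel_def meromorphic2_inverse)

definition minus_mero :: "mero \<Rightarrow> mero \<Rightarrow> mero" where "minus_mero f g = f + - g"

definition divide_mero :: "mero \<Rightarrow> mero \<Rightarrow> mero" where "divide_mero f g = f * inverse g"

instance
proof
  fix a b c :: mero
  show "a + b + c = a + (b + c)"
    by transfer (auto simp: mero_rel_def algebra_simps meromorphic2_add generic_eq_refl)
  show "a + b = b + a"
    by transfer (auto simp: mero_rel_def algebra_simps meromorphic2_add generic_eq_refl)
  show "0 + a = a"
    by transfer (auto simp: mero_rel_def generic_eq_refl)
  show "- a + a = 0"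
    by transfer (auto simp: mero_rel_def generic_eq_refl meromorphic2_const)
  show "a - b = a + - b" by (rule minus_mero_def)
  show "a * b * c = a * (b * c)"
    by transfer (auto simp: mero_rel_def mult.assoc meromorphic2_mult generic_eq_refl)
  show "a * b = b * a"
    by transfer (auto simp: mero_rel_def mult.commute meromorphic2_mult generic_eq_refl)
  show "1 * a = a"
    by transfer (auto simp: mero_rel_def generic_eq_refl)
  show "(a + b) * c = a * c + b * c"
    by transfer (auto simp: mero_rel_def distrib_right meromorphic2_mult meromorphic2_add generic_eq_refl)
  show "(0::mero) \<noteq> 1"
    by transfer (auto simp: mero_rel_def generic_eq_def meromorphic2_const)
  show "a div b = a * inverse b" by (rule divide_mero_def)
  show "inverse (0::mero) = 0"
    by transfer (auto simp: mero_rel_def generic_eq_refl meromorphic2_const)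
  show "inverse a * a = 1" if "a \<noteq> 0"
    using that
  proof transfer
    fix f assume f: "mero_rel f f" "\<not> mero_rel f (\<lambda>_. 0)"
    then have m: "meromorphic2 f" "\<not> generic_eq f (\<lambda>_. 0)"
      by (auto simp: mero_rel_def meromorphic2_const)
    obtain D where "open D" "closure D = UNIV" "\<forall>w\<in>D. f w \<noteq> 0"
      using meromorphic2_nonzero_dense[OF m] by blast
    then have "generic_eq (\<lambda>z. inverse (f z) * f z) (\<lambda>_. 1)"
      unfolding generic_eq_def by (intro exI[of _ D]) auto
    then show "mero_rel (\<lambda>z. inverse (f z) * f z) (\<lambda>_. 1)"
      by (simp add: mero_rel_def meromorphic2_mult meromorphic2_inverse m meromorphic2_const)
  qed
qed

end

text \<open>The class of a meromorphic function. The value \<open>0\<close> for other functions plays no role: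
  for \<open>Im \<tau> > 0\<close> all arguments of \<open>mero_of\<close> below are entire (\<open>meromorphic2_theta1_affine\<close>), and
  all denominators are nonzero elements of the field (\<open>mero_of_theta1_nonzero\<close>).\<close>

definition mero_of :: "(complex ^ 2 \<Rightarrow> complex) \<Rightarrow> mero" where
  "mero_of f = (if meromorphic2 f then abs_mero f else 0)"


section \<open>The theta function\<close>

definition theta1 :: "complex \<Rightarrow> complex \<Rightarrow> complex" where
  "theta1 \<tau> z = (\<Sum>\<^sub>\<infinity>k::int. exp (2 * of_real pi * \<i> *
      ((z + 1/2) * (of_int k + 1/2) + 1/2 * (of_int k + 1/2)\<^sup>2 * \<tau>)))"

lemma summable_exp_minus_abs: "(\<lambda>k::int. exp (- \<bar>real_of_int k\<bar>)) summable_on UNIV"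
proof -
  have "summable (\<lambda>n::nat. exp (-1 :: real) ^ n)"
    by (rule summable_geometric) simp
  moreover have "norm (exp (- real n)) = exp (-1) ^ n" for n
    using exp_of_nat_mult[of n "-1 :: real"] by simp
  ultimately have "summable (\<lambda>n::nat. norm (exp (- real n)))"
    by presburger
  then have g: "(\<lambda>n::nat. exp (- real n)) summable_on UNIV"
    by (rule norm_summable_imp_summable_on)
  have inj: "inj (\<lambda>n. - int n)" by (rule injI) simp
  have "(\<lambda>k::int. exp (- \<bar>real_of_int k\<bar>)) summable_on (range int)"
    unfolding summable_on_reindex[OF inj_of_nat] using g by (simp add: o_def)
  moreover have "(\<lambda>k::int. exp (- \<bar>real_of_int k\<bar>)) summable_on (range (\<lambda>n. - int n))"
    unfolding summable_on_reindex[OF inj] using g by (simp add: o_def)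
  ultimately have "(\<lambda>k::int. exp (- \<bar>real_of_int k\<bar>)) summable_on (range int \<union> range (\<lambda>n. - int n))"
    by (rule summable_on_union)
  moreover have "range int \<union> range (\<lambda>n. - int n) = UNIV"
  proof -
    have "k \<in> range int \<union> range (\<lambda>n. - int n)" for k
      by (cases k rule: int_cases2) simp_all
    then show ?thesis by blast
  qed
  ultimately show ?thesis by metis
qed

lemma theta1_term_bound:
  fixes \<tau> z :: complex
  assumes "Im \<tau> > 0" "\<bar>Im z\<bar> \<le> R"
  shows "norm (exp (2 * of_real pi * \<i> *
      ((z + 1/2) * (of_int k + 1/2) + 1/2 * (of_int k + 1/2)\<^sup>2 * \<tau>)))
    \<le> exp ((2 * pi * R + 1)\<^sup>2 / (4 * pi * Im \<tau>) + 1) * exp (- \<bar>real_of_int k\<bar>)"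
proof -
  define m where "m = real_of_int k + 1/2"
  define y where "y = pi * Im \<tau>"
  define b where "b = 2 * pi * R + 1"
  have y: "y > 0" unfolding y_def using assms by simp
  have m: "of_int k + 1/2 = complex_of_real m" unfolding m_def by simp
  have "Re (2 * of_real pi * \<i> *
      ((z + 1/2) * (of_int k + 1/2) + 1/2 * (of_int k + 1/2)\<^sup>2 * \<tau>))
     = - 2 * pi * Im z * m - y * m\<^sup>2"
    unfolding m y_def by (simp add: power2_eq_square algebra_simps)
  also have "\<dots> \<le> 2 * pi * R * \<bar>m\<bar> - y * \<bar>m\<bar>\<^sup>2"
  proof -
    have "- (Im z * m) \<le> \<bar>Im z\<bar> * \<bar>m\<bar>"
      using abs_ge_minus_self[of "Im z * m"] unfolding abs_mult .
    also have "\<dots> \<le> R * \<bar>m\<bar>" using assms by (intro mult_right_mono) auto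
    finally have "2 * pi * (- (Im z * m)) \<le> 2 * pi * (R * \<bar>m\<bar>)"
      by (intro mult_left_mono) auto
    then show ?thesis by (simp add: algebra_simps)
  qed
  also have "\<dots> = b * \<bar>m\<bar> - y * \<bar>m\<bar>\<^sup>2 - \<bar>m\<bar>"
    unfolding b_def by (simp add: algebra_simps)
  also have "\<dots> \<le> b\<^sup>2 / (4 * y) - \<bar>m\<bar>"
  proof -
    have "(b * x - y * x\<^sup>2) * (4 * y) \<le> b\<^sup>2" for x
    proof -
      have "0 \<le> (b - 2 * y * x)\<^sup>2" by simp
      then show ?thesis by (simp add: power2_eq_square algebra_simps)
    qed
    from this[of "\<bar>m\<bar>"]
    have "(b * \<bar>m\<bar> - y * \<bar>m\<bar>\<^sup>2) * (4 * y) \<le> b\<^sup>2" .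
    then have "b * \<bar>m\<bar> - y * \<bar>m\<bar>\<^sup>2 \<le> b\<^sup>2 / (4 * y)"
      using y by (intro mult_imp_le_div_pos) simp_all
    then show ?thesis by simp
  qed
  also have "\<dots> \<le> b\<^sup>2 / (4 * y) + 1 + - \<bar>real_of_int k\<bar>"
    unfolding m_def by linarith
  finally show ?thesis
    unfolding exp_add[symmetric] norm_exp_eq_Re b_def y_def exp_le_cancel_iff mult.assoc .
qed

lemma theta1_uniform_limit:
  assumes "Im \<tau> > 0" "\<And>z. z \<in> Y \<Longrightarrow> \<bar>Im z\<bar> \<le> R"
  shows "uniform_limit Y (\<lambda>X z. \<Sum>k\<in>X. exp (2 * of_real pi * \<i> *
      ((z + 1/2) * (of_int k + 1/2) + 1/2 * (of_int k + 1/2)\<^sup>2 * \<tau>)))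
    (theta1 \<tau>) (finite_subsets_at_top (UNIV :: int set))"
  unfolding theta1_def[abs_def]
  by (rule Weierstrass_m_test_general[OF theta1_term_bound[OF assms(1,2)]])
     (auto intro!: summable_on_cmult_right summable_exp_minus_abs)

lemma holomorphic_theta1:
  assumes "Im \<tau> > 0"
  shows "theta1 \<tau> holomorphic_on UNIV"
proof -
  have "theta1 \<tau> holomorphic_on ball 0 r" for r
  proof (rule holomorphic_uniform_limit)
    show "uniform_limit (cball 0 r) (\<lambda>X z. \<Sum>k\<in>X. exp (2 * of_real pi * \<i> *
      ((z + 1/2) * (of_int k + 1/2) + 1/2 * (of_int k + 1/2)\<^sup>2 * \<tau>)))
    (theta1 \<tau>) (finite_subsets_at_top (UNIV :: int set))"
      by (rule theta1_uniform_limit[OF assms, of _ r])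
         (use abs_Im_le_cmod order_trans in auto)
  qed (auto intro!: always_eventually continuous_intros holomorphic_intros)
  then have "theta1 \<tau> field_differentiable at z" for z
    by (rule holomorphic_on_imp_differentiable_at[of _ "ball 0 (norm z + 1)"]) auto
  then show ?thesis by (simp add: holomorphic_on_def field_differentiable_at_within)
qed

lemma integral_exp_int_periods:
  fixes k :: int
  shows "((\<lambda>x::real. exp (2 * of_real pi * \<i> * of_int k * of_real x)) has_integral
    (if k = 0 then 1 else 0)) {0..1}"
proof (cases "k = 0")
  case True
  then show ?thesis using has_integral_const_real[of "1::complex" 0 1] by simp
next
  case False
  define c where "c = 2 * of_real pi * \<i> * of_int k"
  have c: "c \<noteq> 0" unfolding c_def using False by simp
  have "((\<lambda>z. exp (c * z) / c) has_field_derivative exp (c * z)) (at z)" for z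
    using c by (auto intro!: derivative_eq_intros)
  then have "((\<lambda>x. exp (c * of_real x) / c) has_vector_derivative exp (c * of_real x)) (at x within {0..1})" for x
    using has_vector_derivative_real_field has_vector_derivative_at_within by blast
  then have "((\<lambda>x::real. exp (c * of_real x)) has_integral
    (exp (c * of_real 1) / c - exp (c * of_real 0) / c)) {0..1}"
    by (intro fundamental_theorem_of_calculus) auto
  moreover have "exp c = 1"
    unfolding c_def exp_eq_1 by (auto intro!: exI[of _ k])
  ultimately show ?thesis using False unfolding c_def by simp
qed

lemma theta1_nonzero:
  assumes "Im \<tau> > 0"
  shows "\<exists>z. theta1 \<tau> z \<noteq> 0"
proof (rule ccontr)
  assume "\<not> ?thesis"
  then have zero: "theta1 \<tau> z = 0" for z by blast
  define t where "t = (\<lambda>(k::int) (x::real). exp (2 * of_real pi * \<i> *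
      ((of_real x + 1/2) * (of_int k + 1/2) + 1/2 * (of_int k + 1/2)\<^sup>2 * \<tau>)))"
  define e where "e = (\<lambda>x::real. exp (- (of_real pi * \<i> * of_real x)))"
  define C where "C = (\<lambda>k::int. exp (2 * of_real pi * \<i> *
      (1/2 * (of_int k + 1/2) + 1/2 * (of_int k + 1/2)\<^sup>2 * \<tau>)))"
  define u where "u = (\<lambda>(k::int) (x::real). C k * exp (2 * of_real pi * \<i> * of_int k * of_real x))"
  have u: "u k x = e x * t k x" for k x
    unfolding u_def t_def e_def C_def exp_add[symmetric]
    by (rule arg_cong[of _ _ exp]) (simp add: algebra_simps add_divide_distrib)
  have ne: "norm (e x) = 1" for x unfolding e_def by simp
  have lim: "uniform_limit {0..1} (\<lambda>X x. \<Sum>k\<in>X. u k x) (\<lambda>x. \<Sum>\<^sub>\<infinity>k. u k x)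
    (finite_subsets_at_top (UNIV :: int set))"
  proof (rule Weierstrass_m_test_general)
    show "norm (u k x) \<le> exp ((2 * pi * 0 + 1)\<^sup>2 / (4 * pi * Im \<tau>) + 1) * exp (- \<bar>real_of_int k\<bar>)" for k x
      using theta1_term_bound[OF assms, of "of_real x" 0 k]
      unfolding u norm_mult ne t_def mult_1 by simp
  qed (auto intro!: summable_on_cmult_right summable_exp_minus_abs)
  have "(\<Sum>\<^sub>\<infinity>k. u k x) = 0" for x
  proof -
    have "(\<Sum>\<^sub>\<infinity>k. u k x) = e x * theta1 \<tau> (of_real x)"
      unfolding u theta1_def t_def by (rule infsum_cmult_right')
    then show ?thesis using zero by simp
  qed
  then have lim0: "uniform_limit {0..1} (\<lambda>X x. \<Sum>k\<in>X. u k x) (\<lambda>x. 0)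
    (finite_subsets_at_top (UNIV :: int set))"
    using lim by simp
  have int: "((\<lambda>x. \<Sum>k\<in>X. u k x) has_integral (if 0 \<in> X then C 0 else 0)) {0..1}"
    if "finite X" for X
  proof -
    have "(u k has_integral C k * (if k = 0 then 1 else 0)) {0..1}" for k
      unfolding u_def by (rule has_integral_mult_right[OF integral_exp_int_periods])
    then have "((\<lambda>x. \<Sum>k\<in>X. u k x) has_integral (\<Sum>k\<in>X. C k * (if k = 0 then 1 else 0))) {0..1}"
      by (intro has_integral_sum that)
    moreover have "(\<Sum>k\<in>X. C k * (if k = 0 then 1 else 0)) = (if 0 \<in> X then C 0 else 0)"
      using that by (simp add: if_distrib sum.delta cong: if_cong)
    ultimately show ?thesis by simp
  qed
  have cont: "continuous_on {0..1} (\<lambda>x. \<Sum>k\<in>X. u k x)" for X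
    unfolding u_def by (intro continuous_intros)
  obtain I J where IJ: "\<And>X. ((\<lambda>x. \<Sum>k\<in>X. u k x) has_integral I X) {0..1}"
    "((\<lambda>x::real. 0::complex) has_integral J) {0..1}" "(I \<longlongrightarrow> J) (finite_subsets_at_top UNIV)"
    by (rule uniform_limit_integral[OF lim0 cont]) (simp, blast)
  have "J = 0" using IJ(2) has_integral_unique has_integral_0 by blast
  have "eventually (\<lambda>X. I X = C 0) (finite_subsets_at_top UNIV)"
  proof (rule eventually_finite_subsets_at_top_weakI[THEN eventually_mp])
    show "eventually (\<lambda>X. finite X \<longrightarrow> I X = C 0) (finite_subsets_at_top UNIV)"
      unfolding eventually_finite_subsets_at_top
    proof (intro exI[of _ "{0}"] conjI allI impI)
      fix Y :: "int set" assume "finite Y \<and> {0} \<subseteq> Y \<and> Y \<subseteq> UNIV" and "finite Y"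
      then show "I Y = C 0" using has_integral_unique[OF IJ(1) int] by auto
    qed auto
  qed auto
  then have "(I \<longlongrightarrow> C 0) (finite_subsets_at_top UNIV)"
    by (rule tendsto_eventually)
  then have "C 0 = J"
    using tendsto_unique[OF finite_subsets_at_top_neq_bot] IJ(3) by blast
  then show False using \<open>J = 0\<close> unfolding C_def by simp
qed


section \<open>The difference operators\<close>

text \<open>The form with \<open>(\<epsilon>\<^sub>j, \<epsilon>\<^sub>k) = \<delta>\<^sub>j\<^sub>k / 2\<close>.\<close>

definition form :: "complex ^ 2 \<Rightarrow> complex ^ 2 \<Rightarrow> complex" where
  "form u v = (\<Sum>j\<in>UNIV. u $ j * v $ j) / 2"

definition eps1 :: "complex ^ 2" where "eps1 = axis 1 1"

definition eps2 :: "complex ^ 2" where "eps2 = axis 2 1"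

lemma form_eps:
  "form eps1 eps1 = 1/2" "form eps2 eps2 = 1/2" "form eps1 eps2 = 0" "form eps2 eps1 = 0"
  unfolding form_def eps1_def eps2_def sum_2 by (simp_all add: axis_def)

lemma holo2_on_theta1_affine:
  assumes "Im \<tau> > 0"
  shows "holo2_on (\<lambda>l. theta1 \<tau> (s * form l p + c)) UNIV"
  unfolding holo2_on_def
proof
  fix l :: "complex ^ 2"
  have lin: "linear (\<lambda>l. s * form l p)"
    by (rule linearI)
       (simp_all add: form_def sum_2 scaleR_conv_of_real[where 'a = complex] field_simps)
  have "((\<lambda>l. s * form l p + c) has_derivative (\<lambda>l. s * form l p + 0)) (at l)"
    by (intro has_derivative_add has_derivative_const bounded_linear_imp_has_derivative
        lin[unfolded linear_conv_bounded_linear])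
  then have d: "((\<lambda>l. s * form l p + c) has_derivative (\<lambda>l. s * form l p)) (at l)" by simp
  obtain D where "(theta1 \<tau> has_field_derivative D) (at (s * form l p + c))"
    using holomorphic_theta1[OF assms] unfolding holomorphic_on_open[OF open_UNIV] by blast
  then have "(theta1 \<tau> has_derivative (*) D) (at (s * form l p + c))"
    unfolding has_field_derivative_def .
  from has_derivative_compose[OF d this]
  have "((\<lambda>l. theta1 \<tau> (s * form l p + c)) has_derivative (\<lambda>v. D * (s * form v p))) (at l)" .
  moreover have "D * (s * form (a *s v) p) = a * (D * (s * form v p))" for a v
    by (simp add: form_def sum_2 algebra_simps)
  ultimately show "\<exists>L. ((\<lambda>l. theta1 \<tau> (s * form l p + c)) has_derivative L) (at l) \<and>
    (\<forall>a v. L (a *s v) = a * L v)" by blast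
qed

lemma meromorphic2_theta1_affine:
  "Im \<tau> > 0 \<Longrightarrow> meromorphic2 (\<lambda>l. theta1 \<tau> (s * form l p + c))"
  by (intro holo2_imp_meromorphic2 holo2_on_theta1_affine)

lemma mero_of_theta1_nonzero:
  assumes "Im \<tau> > 0" "s \<noteq> 0" "p \<noteq> 0"
  shows "mero_of (\<lambda>l. theta1 \<tau> (s * form l p + c)) \<noteq> 0"
proof
  define F where "F = (\<lambda>l. theta1 \<tau> (s * form l p + c))"
  have m: "meromorphic2 F" unfolding F_def by (rule meromorphic2_theta1_affine[OF assms(1)])
  assume "mero_of (\<lambda>l. theta1 \<tau> (s * form l p + c)) = 0"
  then have "abs_mero F = abs_mero (\<lambda>_. 0)"
    using m unfolding F_def[symmetric] mero_of_def zero_mero_def by simp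
  then have "generic_eq F (\<lambda>_. 0)"
    using Quotient3_rel[OF Quotient3_mero, of F "\<lambda>_. 0"] m
    by (auto simp: mero_rel_def meromorphic2_const generic_eq_refl)
  then obtain D where D: "open D" "closure D = UNIV" "\<forall>w\<in>D. F w = 0"
    unfolding generic_eq_def by blast
  obtain i where i: "p $ i \<noteq> 0" using assms(3) by (auto simp: vec_eq_iff)
  obtain z where z: "theta1 \<tau> z \<noteq> 0" using theta1_nonzero[OF assms(1)] by blast
  define l where "l = axis i (2 * (z - c) / (s * p $ i))"
  have "form l p = (z - c) / s"
    unfolding form_def l_def axis_def using i assms(2)
    by (simp add: if_distrib[of "\<lambda>x. x * _"] sum.delta cong: if_cong) (simp add: field_simps)
  then have "F l \<noteq> 0" unfolding F_def using z assms(2) by simp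
  then have "{w\<in>UNIV. F w \<noteq> 0} \<noteq> {}" by blast
  moreover have "open {w\<in>UNIV. F w \<noteq> 0}"
    unfolding F_def by (rule open_nonzero_holo2[OF open_UNIV holo2_on_theta1_affine[OF assms(1)]])
  ultimately have "D \<inter> {w\<in>UNIV. F w \<noteq> 0} \<noteq> {}" using D(2) unfolding dense_iff by blast
  then show False using D(3) by blast
qed

lift_definition T :: "complex \<Rightarrow> complex ^ 2 \<Rightarrow> mero \<Rightarrow> mero"
  is "\<lambda>hb \<beta> f l. f (l + hb *s \<beta>)"
  by (auto simp: mero_rel_def meromorphic2_translate generic_eq_translate)

definition P1 :: "(complex ^ 2) set" where
  "P1 = {eps1, - eps1, eps2, - eps2}"

definition M1 :: "complex \<Rightarrow> complex \<Rightarrow> mero \<Rightarrow> mero" where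
  "M1 \<tau> hb f = (\<Sum>p\<in>P1.
     (\<Prod>q\<in>P1 - {p, - p}.
        mero_of (\<lambda>l. theta1 \<tau> (form l (p + q) - hb)) / mero_of (\<lambda>l. theta1 \<tau> (form l (p + q))))
     * T hb (2 *s p) f)"

definition M2 :: "complex \<Rightarrow> complex \<Rightarrow> mero \<Rightarrow> mero" where
  "M2 \<tau> hb f = (\<Sum>p\<in>{eps1, - eps1}. \<Sum>q\<in>{eps2, - eps2}.
     mero_of (\<lambda>l. theta1 \<tau> (form l (p + q) - hb)) / mero_of (\<lambda>l. theta1 \<tau> (form l (p + q) + hb))
       * T hb (2 *s p) (T hb (2 *s q) f)
     + (mero_of (\<lambda>l. theta1 \<tau> (form l (p + q) - hb)) * mero_of (\<lambda>l. theta1 \<tau> (form l (p + q) + 2 * hb)))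
       / (mero_of (\<lambda>l. theta1 \<tau> (form l (p + q))) * mero_of (\<lambda>l. theta1 \<tau> (form l (p + q) + hb)))
       * f)"

text \<open>\<open>H\<^sub>\<plusminus>\<close> is the case \<open>a = \<epsilon>\<^sub>1 \<plusminus> \<epsilon>\<^sub>2\<close>, where \<open>\<lambda>\<^sub>\<plusminus> = (\<lambda>, a)\<close>.\<close>

definition H :: "complex \<Rightarrow> complex \<Rightarrow> complex ^ 2 \<Rightarrow> mero \<Rightarrow> mero" where
  "H \<tau> hb a f =
     mero_of (\<lambda>l. theta1 \<tau> (form l a - hb)) / mero_of (\<lambda>l. theta1 \<tau> (form l a)) * T hb a f
     + mero_of (\<lambda>l. theta1 \<tau> (- form l a - hb)) / mero_of (\<lambda>l. theta1 \<tau> (- form l a)) * T hb (- a) f"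

definition H_plus :: "complex \<Rightarrow> complex \<Rightarrow> mero \<Rightarrow> mero" where
  "H_plus \<tau> hb = H \<tau> hb (eps1 + eps2)"

definition H_minus :: "complex \<Rightarrow> complex \<Rightarrow> mero \<Rightarrow> mero" where
  "H_minus \<tau> hb = H \<tau> hb (eps1 - eps2)"

end

theory Submission
  imports Defs
begin

text \<open>
  The vectors \<open>a = \<epsilon>\<^sub>1 + \<epsilon>\<^sub>2\<close> and \<open>b = \<epsilon>\<^sub>1 - \<epsilon>\<^sub>2\<close> are orthonormal for the form. Write
  \<open>w\<^sub>p = \<theta>\<^sub>1(\<lambda>\<^sub>p - \<hbar>) / \<theta>\<^sub>1(\<lambda>\<^sub>p)\<close>, so that \<open>H\<^sub>+\<close> has the coefficients \<open>w\<^sub>a\<close>, \<open>w\<^sub>-\<^sub>a\<close> and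
  \<open>H\<^sub>-\<close> has the coefficients \<open>w\<^sub>b\<close>, \<open>w\<^sub>-\<^sub>b\<close>. A shift by \<open>\<hbar>\<beta>\<close> replaces \<open>\<lambda>\<^sub>p\<close> by
  \<open>\<lambda>\<^sub>p + \<hbar> (\<beta>, p)\<close>, and three consequences give the two identities.

  \<^item> Since \<open>(a, b) = 0\<close>, shifts along \<open>a\<close> leave the coefficients of \<open>H\<^sub>-\<close> unchanged, so
    \<open>H\<^sub>+ H\<^sub>-\<close> is the sum of \<open>w\<^sub>s w\<^sub>t T\<^bsub>s + t\<^esub>\<close> over \<open>s = \<plusminus>a\<close>, \<open>t = \<plusminus>b\<close>
    (\<open>H_comp_orthogonal\<close>). The four vectors \<open>s + t\<close> are \<open>2p\<close> with \<open>p\<close> running through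
    \<open>P1\<close>, and then \<open>s\<close>, \<open>t\<close> are the two vectors \<open>p + q\<close> with \<open>q \<noteq> \<plusminus>p\<close>: this is \<open>M1\<close>.

  \<^item> Since \<open>(a, a) = 1\<close>, the coefficient of \<open>T\<^sub>2\<^sub>a\<close> in \<open>H\<^sub>+\<^sup>2\<close> is
    \<open>\<theta>\<^sub>1(\<lambda>\<^sub>a - \<hbar>) / \<theta>\<^sub>1(\<lambda>\<^sub>a) \<cdot> \<theta>\<^sub>1(\<lambda>\<^sub>a) / \<theta>\<^sub>1(\<lambda>\<^sub>a + \<hbar>)\<close>, which telescopes:
    the cancelled factor is a nonzero element of the field of meromorphic functions.

  \<^item> The product of \<open>w\<^sub>a T\<^sub>a\<close> and \<open>w\<^sub>-\<^sub>a T\<^sub>-\<^sub>a\<close> is the multiplication by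
    \<open>\<theta>\<^sub>1(\<lambda>\<^sub>a - \<hbar>) / \<theta>\<^sub>1(\<lambda>\<^sub>a) \<cdot> \<theta>\<^sub>1(-\<lambda>\<^sub>a - 2\<hbar>) / \<theta>\<^sub>1(-\<lambda>\<^sub>a - \<hbar>)\<close>, and because \<open>\<theta>\<^sub>1\<close> is odd
    this is the potential term of \<open>M2\<close>. Replacing \<open>a\<close> by \<open>-a\<close>, \<open>b\<close> and \<open>-b\<close> yields the
    remaining terms (\<open>H_squared\<close>).
\<close>

section \<open>Oddness of the theta function\<close>

text \<open>The reflection \<open>k \<mapsto> -1 - k\<close> of the summation index sends \<open>k + 1/2\<close> to its negative; it
  keeps the quadratic exponent, and the shift by \<open>1/2\<close> in \<open>z + 1/2\<close> produces the
  sign \<open>exp (- 2 \<pi> \<i> (k + 1/2)) = - 1\<close>.\<close>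

lemma theta1_minus: "theta1 \<tau> (- z) = - theta1 \<tau> z"
proof -
  define t where "t = (\<lambda>z (k::int). exp (2 * of_real pi * \<i> *
      ((z + 1/2) * (of_int k + 1/2) + 1/2 * (of_int k + 1/2)\<^sup>2 * \<tau>)))"
  have th: "theta1 \<tau> z = (\<Sum>\<^sub>\<infinity>k. t z k)" for z
    unfolding theta1_def t_def ..
  have bij: "bij (\<lambda>k::int. - 1 - k)"
    by (rule o_bij[where g = "\<lambda>k. - 1 - k"]) (auto simp: fun_eq_iff)
  have t: "t (- z) (- 1 - k) = - t z k" for k
  proof -
    have "2 * of_real pi * \<i> * ((- z + 1/2) * (of_int (- 1 - k) + 1/2)
          + 1/2 * (of_int (- 1 - k) + 1/2)\<^sup>2 * \<tau>)
        = 2 * of_real pi * \<i> * ((z + 1/2) * (of_int k + 1/2) + 1/2 * (of_int k + 1/2)\<^sup>2 * \<tau>)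
          + (of_int (2 * (- k - 1)) * (of_real pi * \<i>) + of_real pi * \<i>)"
      by (simp add: power2_eq_square field_simps)
    moreover have "exp (of_int (2 * (- k - 1)) * (of_real pi * \<i>)) = (1::complex)"
      unfolding exp_eq_1 by (auto intro!: exI[of _ "- k - 1"])
    ultimately show ?thesis
      unfolding t_def by (simp only: exp_add exp_pi_i mult_1 mult_minus1_right)
  qed
  have "theta1 \<tau> (- z) = (\<Sum>\<^sub>\<infinity>k. t (- z) (- 1 - k))"
    unfolding th by (rule infsum_reindex_bij_betw[OF bij, symmetric])
  also have "\<dots> = - theta1 \<tau> z"
    unfolding t th by (rule infsum_uminus)
  finally show ?thesis .
qed

section \<open>Shifts of meromorphic functions\<close>

lemma form_add_left: "form (u + v) p = form u p + form v p"
  by (simp add: form_def sum_2 field_simps)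

lemma form_minus_left: "form (- u) p = - form u p"
  by (simp add: form_def sum_2 field_simps)

lemma form_scale_left: "form (c *s u) p = c * form u p"
  by (simp add: form_def sum_2 field_simps)

lemma form_minus_right: "form u (- p) = - form u p"
  by (simp add: form_def sum_2 field_simps)

lemma T_add: "T hb \<beta> (f + g) = T hb \<beta> f + T hb \<beta> g"
  by transfer
     (auto simp: mero_rel_def meromorphic2_add meromorphic2_translate generic_eq_refl)

lemma T_mult: "T hb \<beta> (f * g) = T hb \<beta> f * T hb \<beta> g"
  by transfer
     (auto simp: mero_rel_def meromorphic2_mult meromorphic2_translate generic_eq_refl)

lemma T_inverse: "T hb \<beta> (inverse f) = inverse (T hb \<beta> f)"
  by transfer
     (auto simp: mero_rel_def meromorphic2_inverse meromorphic2_translate generic_eq_refl)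

lemma T_divide: "T hb \<beta> (f / g) = T hb \<beta> f / T hb \<beta> g"
  by (simp add: divide_inverse T_mult T_inverse)

lemma T_T: "T hb \<beta> (T hb \<gamma> f) = T hb (\<beta> + \<gamma>) f"
proof transfer
  fix hb :: complex and \<beta> \<gamma> :: "complex ^ 2" and f
  assume f: "mero_rel f f"
  have eq: "l + hb *s \<beta> + hb *s \<gamma> = l + hb *s (\<beta> + \<gamma>)" for l
    by (simp add: vec_eq_iff algebra_simps)
  show "mero_rel (\<lambda>l. f (l + hb *s \<beta> + hb *s \<gamma>)) (\<lambda>l. f (l + hb *s (\<beta> + \<gamma>)))"
    unfolding eq using f by (simp add: mero_rel_def meromorphic2_translate generic_eq_refl)
qed

lemma T_0: "T hb 0 f = f"
  by transfer (auto simp: mero_rel_def)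

lemma T_mero_of:
  assumes "meromorphic2 f"
  shows "T hb \<beta> (mero_of f) = mero_of (\<lambda>l. f (l + hb *s \<beta>))"
  using assms by (simp add: mero_of_def meromorphic2_translate T.abs_eq mero_rel_def generic_eq_refl)

lemma mero_of_uminus:
  assumes "meromorphic2 f"
  shows "mero_of (\<lambda>l. - f l) = - mero_of f"
proof -
  have "meromorphic2 (\<lambda>l. - f l)"
    using meromorphic2_mult[OF meromorphic2_const[of "- 1"] assms] by simp
  then show ?thesis
    using assms by (simp add: mero_of_def uminus_mero.abs_eq mero_rel_def generic_eq_refl)
qed

definition theta_shift :: "complex \<Rightarrow> complex ^ 2 \<Rightarrow> complex \<Rightarrow> mero" where
  "theta_shift \<tau> p c = mero_of (\<lambda>l. theta1 \<tau> (form l p + c))"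

lemma mero_of_theta1_eq_theta_shift:
  "mero_of (\<lambda>l. theta1 \<tau> (form l p)) = theta_shift \<tau> p 0"
  "mero_of (\<lambda>l. theta1 \<tau> (- form l p)) = theta_shift \<tau> (- p) 0"
  "mero_of (\<lambda>l. theta1 \<tau> (form l p + c)) = theta_shift \<tau> p c"
  "mero_of (\<lambda>l. theta1 \<tau> (form l p - c)) = theta_shift \<tau> p (- c)"
  "mero_of (\<lambda>l. theta1 \<tau> (- form l p - c)) = theta_shift \<tau> (- p) (- c)"
  by (simp_all add: theta_shift_def form_minus_right)

lemma theta_shift_nonzero:
  assumes "Im \<tau> > 0" "p \<noteq> 0"
  shows "theta_shift \<tau> p c \<noteq> 0"
  using mero_of_theta1_nonzero[OF assms(1) _ assms(2), of 1 c] by (simp add: theta_shift_def)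

lemma T_theta_shift:
  assumes "Im \<tau> > 0"
  shows "T hb \<beta> (theta_shift \<tau> p c) = theta_shift \<tau> p (c + hb * form \<beta> p)"
  using meromorphic2_theta1_affine[OF assms, of 1 p c]
  by (simp add: theta_shift_def T_mero_of form_add_left form_scale_left algebra_simps)

lemma theta_shift_minus:
  assumes "Im \<tau> > 0"
  shows "theta_shift \<tau> (- p) c = - theta_shift \<tau> p (- c)"
proof -
  have "theta1 \<tau> (form l (- p) + c) = - theta1 \<tau> (form l p + - c)" for l
    using theta1_minus[of \<tau> "form l p + - c"] by (simp add: form_minus_right add.commute)
  then show ?thesis
    using meromorphic2_theta1_affine[OF assms, of 1 p "- c"]
    by (simp add: theta_shift_def mero_of_uminus)
qed

section \<open>Products of the two-term operators\<close>

definition weight :: "complex \<Rightarrow> complex \<Rightarrow> complex ^ 2 \<Rightarrow> mero" where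
  "weight \<tau> hb p = theta_shift \<tau> p (- hb) / theta_shift \<tau> p 0"

lemma H_weight: "H \<tau> hb a f = weight \<tau> hb a * T hb a f + weight \<tau> hb (- a) * T hb (- a) f"
  unfolding H_def weight_def mero_of_theta1_eq_theta_shift ..

lemma T_weight_orthogonal:
  assumes "Im \<tau> > 0" "form \<beta> p = 0"
  shows "T hb \<beta> (weight \<tau> hb p) = weight \<tau> hb p"
  using assms by (simp add: weight_def T_divide T_theta_shift)

text \<open>For orthogonal \<open>a\<close>, \<open>b\<close> the coefficients of \<open>H b\<close> are constants for the shifts in
  \<open>H a\<close>.\<close>

lemma H_comp_orthogonal:
  assumes "Im \<tau> > 0" "form a b = 0"
  shows "H \<tau> hb a (H \<tau> hb b f) =
     weight \<tau> hb a * weight \<tau> hb b * T hb (a + b) f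
   + weight \<tau> hb a * weight \<tau> hb (- b) * T hb (a - b) f
   + weight \<tau> hb (- a) * weight \<tau> hb b * T hb (- a + b) f
   + weight \<tau> hb (- a) * weight \<tau> hb (- b) * T hb (- a - b) f"
  using assms
  by (simp add: H_weight T_add T_mult T_T T_weight_orthogonal form_minus_left form_minus_right
      algebra_simps)

text \<open>The \<open>(p, q)\<close> summand of \<open>M2\<close> depends only on \<open>r = p + q\<close>, because
  \<open>T\<^sub>2\<^sub>p T\<^sub>2\<^sub>q = T\<^sub>2\<^sub>r\<close>; this is that summand.\<close>

definition M2_part :: "complex \<Rightarrow> complex \<Rightarrow> complex ^ 2 \<Rightarrow> mero \<Rightarrow> mero" where
  "M2_part \<tau> hb r f =
     theta_shift \<tau> r (- hb) / theta_shift \<tau> r hb * T hb (2 *s r) f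
     + (theta_shift \<tau> r (- hb) * theta_shift \<tau> r (2 * hb))
       / (theta_shift \<tau> r 0 * theta_shift \<tau> r hb) * f"

text \<open>The first summand arises from a telescoping product of theta quotients; in the second one,
  the two signs produced by the oddness of \<open>\<theta>\<^sub>1\<close> cancel.\<close>

lemma weight_T_H_unit:
  assumes "Im \<tau> > 0" "form r r = 1"
  shows "weight \<tau> hb r * T hb r (H \<tau> hb r f) = M2_part \<tau> hb r f"
proof -
  have r: "r \<noteq> 0" using assms(2) by (auto simp: form_def)
  have nz: "theta_shift \<tau> r 0 \<noteq> 0" by (rule theta_shift_nonzero[OF assms(1) r])
  have "T hb r (weight \<tau> hb r) = theta_shift \<tau> r 0 / theta_shift \<tau> r hb"
    using assms by (simp add: weight_def T_divide T_theta_shift)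
  moreover have "T hb r (weight \<tau> hb (- r)) = theta_shift \<tau> r (2 * hb) / theta_shift \<tau> r hb"
    using assms
    by (simp add: weight_def T_divide T_theta_shift form_minus_right theta_shift_minus)
  moreover have "2 *s r = r + r" by (simp add: vec_eq_iff)
  ultimately show ?thesis
    using nz
    by (simp add: H_weight M2_part_def T_add T_mult T_T T_0 distrib_left)
       (simp add: weight_def)
qed

text \<open>Both summands of the outer \<open>H a\<close> are instances of the preceding lemma, for \<open>r = a\<close> and
  for \<open>r = - a\<close>, because \<open>H\<close> is even in \<open>a\<close>.\<close>

lemma H_squared:
  assumes "Im \<tau> > 0" "form a a = 1"
  shows "H \<tau> hb a (H \<tau> hb a f) = M2_part \<tau> hb a f + M2_part \<tau> hb (- a) f"
proof -
  have minus: "H \<tau> hb (- a) f = H \<tau> hb a f"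
    by (simp add: H_weight add.commute)
  have "form (- a) (- a) = 1"
    using assms(2) by (simp add: form_minus_left form_minus_right)
  from weight_T_H_unit[OF assms(1) this, of hb f] weight_T_H_unit[OF assms, of hb f]
  show ?thesis
    unfolding minus by (simp add: H_weight[of \<tau> hb a "H \<tau> hb a f"])
qed

section \<open>The factorisations\<close>

lemma eps_distinct:
  "eps1 \<noteq> - eps1" "eps2 \<noteq> - eps2"
  "eps1 \<noteq> eps2" "eps1 \<noteq> - eps2" "- eps1 \<noteq> eps2"
  by (auto simp: eps1_def eps2_def vec_eq_iff forall_2 axis_def)

lemma M1_expand:
  "M1 \<tau> hb f =
     weight \<tau> hb (eps1 + eps2) * weight \<tau> hb (eps1 - eps2) * T hb (2 *s eps1) f
   + weight \<tau> hb (- eps1 + eps2) * weight \<tau> hb (- eps1 - eps2) * T hb (2 *s (- eps1)) f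
   + weight \<tau> hb (eps1 + eps2) * weight \<tau> hb (- eps1 + eps2) * T hb (2 *s eps2) f
   + weight \<tau> hb (eps1 - eps2) * weight \<tau> hb (- eps1 - eps2) * T hb (2 *s (- eps2)) f"
proof -
  have P: "P1 - {eps1, - eps1} = {eps2, - eps2}" "P1 - {- eps1, eps1} = {eps2, - eps2}"
    "P1 - {eps2, - eps2} = {eps1, - eps1}" "P1 - {- eps2, eps2} = {eps1, - eps1}"
    using eps_distinct by (auto simp: P1_def)
  have "M1 \<tau> hb f = (\<Sum>p\<in>P1. (\<Prod>q\<in>P1 - {p, - p}. weight \<tau> hb (p + q)) * T hb (2 *s p) f)"
    unfolding M1_def weight_def mero_of_theta1_eq_theta_shift ..
  also have "\<dots> = (\<Sum>p\<in>{eps1, - eps1, eps2, - eps2}.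
      (\<Prod>q\<in>P1 - {p, - p}. weight \<tau> hb (p + q)) * T hb (2 *s p) f)"
    by (simp only: P1_def)
  finally show ?thesis
    using eps_distinct eps_distinct[symmetric]
    by (simp add: P add.assoc add.commute[of eps2 eps1] minus_diff_commute[of eps2 eps1])
qed

lemma M2_expand:
  "M2 \<tau> hb f = M2_part \<tau> hb (eps1 + eps2) f + M2_part \<tau> hb (eps1 - eps2) f
     + M2_part \<tau> hb (- eps1 + eps2) f + M2_part \<tau> hb (- eps1 - eps2) f"
proof -
  have scale: "2 *s p + 2 *s q = 2 *s (p + q)" for p q :: "complex ^ 2"
    by (simp add: vec_eq_iff algebra_simps)
  have "M2 \<tau> hb f = (\<Sum>p\<in>{eps1, - eps1}. \<Sum>q\<in>{eps2, - eps2}. M2_part \<tau> hb (p + q) f)"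
    unfolding M2_def M2_part_def mero_of_theta1_eq_theta_shift T_T scale ..
  then show ?thesis
    using eps_distinct by (simp add: add.assoc)
qed

theorem lemma2:
  fixes \<tau> hb :: complex
  assumes "Im \<tau> > 0"
  shows "M1 \<tau> hb = H_plus \<tau> hb \<circ> H_minus \<tau> hb \<and>
    M2 \<tau> hb = (\<lambda>f. (H_plus \<tau> hb ^^ 2) f + (H_minus \<tau> hb ^^ 2) f)"
proof
  define a where "a = eps1 + eps2"
  define b where "b = eps1 - eps2"
  have form: "form a b = 0" "form a a = 1" "form b b = 1"
    by (simp_all add: a_def b_def form_def sum_2 eps1_def eps2_def axis_def)
  have neg: "- eps1 + eps2 = - b" "- eps1 - eps2 = - a"
    by (simp_all add: a_def b_def)
  have double: "2 *s eps1 = a + b" "2 *s (- eps1) = - a - b"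
    "2 *s eps2 = a - b" "2 *s (- eps2) = - a + b"
    by (simp_all add: a_def b_def vec_eq_iff)
  show "M1 \<tau> hb = H_plus \<tau> hb \<circ> H_minus \<tau> hb"
  proof
    fix f
    show "M1 \<tau> hb f = (H_plus \<tau> hb \<circ> H_minus \<tau> hb) f"
      unfolding H_plus_def H_minus_def comp_apply M1_expand neg
        a_def[symmetric] b_def[symmetric] double H_comp_orthogonal[OF assms form(1)]
      by (simp add: algebra_simps)
  qed
  show "M2 \<tau> hb = (\<lambda>f. (H_plus \<tau> hb ^^ 2) f + (H_minus \<tau> hb ^^ 2) f)"
  proof
    fix f
    have "M2 \<tau> hb f = H \<tau> hb a (H \<tau> hb a f) + H \<tau> hb b (H \<tau> hb b f)"
      unfolding M2_expand neg a_def[symmetric] b_def[symmetric]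
        H_squared[OF assms form(2)] H_squared[OF assms form(3)]
      by (simp add: algebra_simps)
    then show "M2 \<tau> hb f = (H_plus \<tau> hb ^^ 2) f + (H_minus \<tau> hb ^^ 2) f"
      by (simp add: H_plus_def H_minus_def a_def b_def numeral_2_eq_2)
  qed
qed

end
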